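(* Let $\mathcal{H}$ be a complex Hilbert space and let $T\in\mathbb{B}(\mathcal{H})$ have the Cartesian decomposition $T=A+iB$. Then $$\frac{1}{4}\big\|\,|T|^2+|T^*|^2\,\big\|\le \frac{\sqrt{2}}{2}\,\omega\big(A^2+iB^2\big)\le \omega^2(T).$$
   Context: $\mathbb{B}(\mathcal{H})$ is the $C^*$-algebra of bounded linear operators on $\mathcal{H}$, with the usual operator norm $\|\cdot\|$; $T^*$ is the adjoint of $T$ and $|T|=(T^*T)^{1/2}$. The Cartesian decomposition of $T$ is $T=A+iB$ with $A=\Re T=\frac{T+T^*}{2}$ and $B=\Im T=\frac{T-T^*}{2i}$, both self-adjoint. The numerical radius is $\omega(T)=\sup_{\|x\|=1}|\langle Tx,x\rangle|$, and $\omega^2(T)$ means $(\omega(T))^2$. *)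

theory Defs
  imports "HOL-Analysis.Analysis"
begin

text \<open>
  A complex inner product space is rendered as a real inner product space together with a
  complex scalar multiplication extending the real one and a sesquilinear form (linear in the
  first argument) whose real part is the given real inner product. Hence the norm is
  \<open>norm x = sqrt (Re (cinner x x))\<close>; positive definiteness of \<open>cinner\<close> is inherited from
  \<open>real_inner\<close>, and \<open>1 *\<^sub>C x = x\<close> from \<open>scaleR\<close>.
\<close>

class complex_inner = real_inner +
  fixes scaleC :: "complex \<Rightarrow> 'a \<Rightarrow> 'a"  (infixr "*\<^sub>C" 75)
    and cinner :: "'a \<Rightarrow> 'a \<Rightarrow> complex"
  assumes scaleR_eq_scaleC: "r *\<^sub>R x = complex_of_real r *\<^sub>C x"
    and scaleC_add_right: "a *\<^sub>C (x + y) = a *\<^sub>C x + a *\<^sub>C y"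
    and scaleC_add_left: "(a + b) *\<^sub>C x = a *\<^sub>C x + b *\<^sub>C x"
    and scaleC_scaleC: "a *\<^sub>C b *\<^sub>C x = (a * b) *\<^sub>C x"
    and cinner_commute: "cinner x y = cnj (cinner y x)"
    and cinner_add_left: "cinner (x + y) z = cinner x z + cinner y z"
    and cinner_scaleC_left: "cinner (a *\<^sub>C x) y = a * cinner x y"
    and inner_eq_Re_cinner: "inner x y = Re (cinner x y)"

class chilbert_space = complex_inner + complete_space

text \<open>
  Elements of \<open>\<bbbB>(\<H>)\<close> are functions satisfying \<open>bounded_clinear\<close>; their operator norm
  is the library's \<open>onorm\<close>, their product is composition, and \<open>T ^^ 2\<close> is the operator square.
\<close>

definition bounded_clinear :: "('a::complex_inner \<Rightarrow> 'a) \<Rightarrow> bool" where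
  "bounded_clinear T \<longleftrightarrow> bounded_linear T \<and> (\<forall>a x. T (a *\<^sub>C x) = a *\<^sub>C T x)"

text \<open>For bounded \<open>T\<close> on a Hilbert space the map chosen here exists and is unique.\<close>

definition cadjoint :: "('a::complex_inner \<Rightarrow> 'a) \<Rightarrow> 'a \<Rightarrow> 'a" where
  "cadjoint T = (SOME S. \<forall>x y. cinner (T x) y = cinner x (S y))"

definition positive_op :: "('a::complex_inner \<Rightarrow> 'a) \<Rightarrow> bool" where
  "positive_op P \<longleftrightarrow> bounded_clinear P \<and> (\<forall>x. cinner (P x) x \<in> \<real>\<^sub>\<ge>\<^sub>0)"

text \<open>A positive operator on a Hilbert space has exactly one positive square root.\<close>

definition op_sqrt :: "('a::complex_inner \<Rightarrow> 'a) \<Rightarrow> 'a \<Rightarrow> 'a" where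
  "op_sqrt P = (SOME S. positive_op S \<and> S \<circ> S = P)"

definition op_abs :: "('a::complex_inner \<Rightarrow> 'a) \<Rightarrow> 'a \<Rightarrow> 'a" where
  "op_abs T = op_sqrt (cadjoint T \<circ> T)"

definition op_Re :: "('a::complex_inner \<Rightarrow> 'a) \<Rightarrow> 'a \<Rightarrow> 'a" where
  "op_Re T = (\<lambda>x. (1 / 2) *\<^sub>C (T x + cadjoint T x))"

definition op_Im :: "('a::complex_inner \<Rightarrow> 'a) \<Rightarrow> 'a \<Rightarrow> 'a" where
  "op_Im T = (\<lambda>x. (1 / (2 * \<i>)) *\<^sub>C (T x - cadjoint T x))"

text \<open>
  Inserting \<open>0\<close> changes nothing on a nonzero space, all the values being nonnegative; on the zero
  space, which has no unit vectors, it makes the numerical radius \<open>0\<close>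
  (\<open>Sup {}\<close> is unspecified for reals).
\<close>

definition numerical_radius :: "('a::complex_inner \<Rightarrow> 'a) \<Rightarrow> real" where
  "numerical_radius T = Sup (insert 0 {cmod (cinner (T x) x) | x. norm x = 1})"

end

theory Submission imports Defs begin

text \<open>
  Since \<open>|T|\<^sup>2 + |T\<^sup>*|\<^sup>2 = 2 (A\<^sup>2 + B\<^sup>2)\<close> and \<open>A\<close>, \<open>B\<close> are self-adjoint, everything reduces to the
  quadratic forms \<open>\<parallel>A x\<parallel>\<^sup>2\<close> and \<open>\<parallel>B x\<parallel>\<^sup>2\<close>: the first inequality is \<open>a + b \<le> \<surd>2 |a + i b|\<close>, and the
  second follows from \<open>\<parallel>A\<parallel>, \<parallel>B\<parallel> \<le> \<omega>(T)\<close>, because the norm of a self-adjoint operator is the bound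
  of its quadratic form. Adjoints come from Riesz representation, obtained by minimising
  \<open>\<parallel>x\<parallel>\<^sup>2 - 2 f x\<close>. The square root of \<open>1 - Q\<close> is \<open>1 - Y\<close>, where \<open>Y\<close> is the limit of
  \<open>Y\<^sub>n\<^sub>+\<^sub>1 = (Q + Y\<^sub>n\<^sup>2) / 2\<close>; the increments are dominated in norm by those of the same iteration for
  the scalar \<open>1\<close>, so the convergence is in operator norm.
\<close>

instance chilbert_space \<subseteq> banach ..

subsection \<open>Riesz representation\<close>

text \<open>The parallelogram law, in which the linear terms cancel. If the value of
  \<open>J\<close> at the midpoint is bounded below by the infimum, two near-minimisers must be
  close to each other.\<close>

lemma norm_diff_sq_quadratic_functional:
  fixes f :: "'a::real_inner \<Rightarrow> real"
  assumes "linear f" and J: "\<And>x. J x = (norm x)\<^sup>2 - 2 * f x"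
  shows "(norm (x - y))\<^sup>2 = 2 * J x + 2 * J y - 4 * J ((1 / 2) *\<^sub>R (x + y))"
proof -
  have "f ((1 / 2) *\<^sub>R (x + y)) = (f x + f y) / 2"
    using assms(1) by (simp add: linear_cmul linear_add)
  then show ?thesis
    by (simp add: J power2_norm_eq_inner inner_simps inner_commute[of y x] algebra_simps)
qed

lemma riesz_representation:
  fixes f :: "'a::{real_inner,complete_space} \<Rightarrow> real"
  assumes f: "bounded_linear f"
  shows "\<exists>z. \<forall>x. f x = inner x z"
proof -
  interpret f: bounded_linear f by fact
  define J where "J x = (norm x)\<^sup>2 - 2 * f x" for x
  obtain K where K: "norm (f x) \<le> norm x * K" for x
    using f.bounded by blast
  \<comment> \<open>Completing the square: \<open>J x\<close> is at least
    \<open>(norm x)^2 - 2 * K * norm x\<close>, which equals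
    \<open>(norm x - K)^2 - K^2\<close>.\<close>
  have J_lower: "- K\<^sup>2 \<le> J x" for x
  proof -
    have "0 \<le> (norm x - K)\<^sup>2" by simp
    then show ?thesis
      using K[of x] by (simp add: J_def power2_eq_square algebra_simps)
  qed
  define m where "m = Inf (range J)"
  have bdd: "bdd_below (range J)"
    using J_lower by (auto intro!: bdd_belowI)
  have m_le: "m \<le> J x" for x
    unfolding m_def by (rule cInf_lower[OF _ bdd]) auto
  have "\<exists>x. J x < m + inverse (real (Suc n))" for n
    using cInf_lessD[of "range J" "m + inverse (real (Suc n))"] by (auto simp: m_def)
  then obtain u where u: "J (u n) < m + inverse (real (Suc n))" for n
    by metis
  have J_lim: "(\<lambda>n. J (u n)) \<longlonglongrightarrow> m"
  proof (rule tendsto_sandwich)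
    show "\<forall>\<^sub>F n in sequentially. m \<le> J (u n)"
      "\<forall>\<^sub>F n in sequentially. J (u n) \<le> m + inverse (real (Suc n))"
      using m_le u by (auto intro: always_eventually less_imp_le)
    show "(\<lambda>n. m + inverse (real (Suc n))) \<longlonglongrightarrow> m"
      by (rule LIMSEQ_inverse_real_of_nat_add)
  qed simp
  \<comment> \<open>The midpoint of \<open>u i\<close> and \<open>u j\<close> has
    \<open>J\<close>-value at least \<open>m\<close>.\<close>
  have dist_u: "(norm (u i - u j))\<^sup>2 \<le> 2 * (J (u i) - m) + 2 * (J (u j) - m)" for i j
    using norm_diff_sq_quadratic_functional[OF f.linear J_def, of "u i" "u j"]
      m_le[of "(1 / 2) *\<^sub>R (u i + u j)"] by (smt (verit))
  have "Cauchy u"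
  proof (rule CauchyI)
    fix e :: real assume "0 < e"
    then have "\<forall>\<^sub>F n in sequentially. J (u n) < m + e\<^sup>2 / 4"
      by (intro order_tendstoD(2)[OF J_lim]) simp
    then obtain N where N: "\<And>n. n \<ge> N \<Longrightarrow> J (u n) < m + e\<^sup>2 / 4"
      by (auto simp: eventually_sequentially)
    have "norm (u i - u j) < e" if "i \<ge> N" "j \<ge> N" for i j
    proof -
      have "(norm (u i - u j))\<^sup>2 < e\<^sup>2"
        using dist_u[of i j] N[OF that(1)] N[OF that(2)] by (simp add: field_simps)
      then show ?thesis
        using \<open>0 < e\<close> by (simp add: power_less_imp_less_base)
    qed
    then show "\<exists>M. \<forall>i\<ge>M. \<forall>j\<ge>M. norm (u i - u j) < e" by blast
  qed
  then obtain z where z: "u \<longlonglongrightarrow> z"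
    by (auto simp: Cauchy_convergent_iff convergent_def)
  have "(\<lambda>n. J (u n)) \<longlonglongrightarrow> J z"
    unfolding J_def by (intro tendsto_intros f.tendsto z)
  then have Jz: "J z = m"
    using J_lim LIMSEQ_unique by blast
  \<comment> \<open>First variation at the minimiser: along any direction \<open>x\<close> with
    \<open>d\<close> nonzero, \<open>J\<close> could be pushed below \<open>m\<close>. The
    \<open>t\<close> chosen below minimises the quadratic
    \<open>2 * t * d + t^2 * (norm x)^2\<close>.\<close>
  have "f x = inner x z" for x
  proof (rule ccontr)
    define d where "d = inner x z - f x"
    assume "f x \<noteq> inner x z"
    then have d: "d \<noteq> 0" and x: "x \<noteq> 0" by (auto simp: d_def f.zero)
    have Jt: "J (z + t *\<^sub>R x) = m + (2 * t * d + t\<^sup>2 * (norm x)\<^sup>2)" for t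
      unfolding Jz[symmetric] J_def d_def power2_norm_eq_inner
      by (simp add: inner_simps f.add f.scaleR inner_commute[of z x] power2_eq_square algebra_simps)
    define t where "t = - d / (norm x)\<^sup>2"
    have "2 * t * d + t\<^sup>2 * (norm x)\<^sup>2 = - d\<^sup>2 / (norm x)\<^sup>2"
      using x by (simp add: t_def power2_eq_square field_simps)
    moreover have "- d\<^sup>2 / (norm x)\<^sup>2 < 0"
      using d x by simp
    ultimately show False
      using m_le[of "z + t *\<^sub>R x"] by (simp add: Jt)
  qed
  then show ?thesis by blast
qed

subsection \<open>Complex inner products and adjoints\<close>

lemma cinner_scaleC_right: "cinner x (a *\<^sub>C y) = cnj a * cinner x y"
  for x y :: "'a::complex_inner"
  by (simp add: cinner_commute[of x] cinner_scaleC_left)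

lemma cinner_add_right: "cinner x (y + z) = cinner x y + cinner x z"
  for x y z :: "'a::complex_inner"
  by (simp add: cinner_commute[of x] cinner_add_left)

lemma scaleC_minus_one: "(- 1) *\<^sub>C x = - x" for x :: "'a::complex_inner"
  using scaleR_eq_scaleC[of "- 1" x] by simp

lemma scaleC_one: "1 *\<^sub>C x = x" for x :: "'a::complex_inner"
  using scaleR_eq_scaleC[of 1 x] by simp

lemma cinner_minus_left: "cinner (- x) y = - cinner x y" for x y :: "'a::complex_inner"
  using cinner_scaleC_left[of "- 1" x y] by (simp add: scaleC_minus_one)

lemma cinner_minus_right: "cinner x (- y) = - cinner x y" for x y :: "'a::complex_inner"
  by (simp add: cinner_commute[of x] cinner_minus_left)

lemma cinner_diff_left: "cinner (x - y) z = cinner x z - cinner y z"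
  for x y z :: "'a::complex_inner"
  using cinner_add_left[of x "- y" z] by (simp add: cinner_minus_left)

lemma cinner_diff_right: "cinner x (y - z) = cinner x y - cinner x z"
  for x y z :: "'a::complex_inner"
  using cinner_add_right[of x y "- z"] by (simp add: cinner_minus_right)

lemma cinner_scaleR_left: "cinner (r *\<^sub>R x) y = of_real r * cinner x y"
  for x y :: "'a::complex_inner"
  by (simp add: scaleR_eq_scaleC cinner_scaleC_left)

lemma cinner_scaleR_right: "cinner x (r *\<^sub>R y) = of_real r * cinner x y"
  for x y :: "'a::complex_inner"
  by (simp add: scaleR_eq_scaleC cinner_scaleC_right)

lemmas cinner_simps =
  cinner_add_left cinner_add_right cinner_diff_left cinner_diff_right
  cinner_scaleC_left cinner_scaleC_right cinner_scaleR_left cinner_scaleR_right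

lemma cinner_self: "cinner x x = of_real ((norm x)\<^sup>2)" for x :: "'a::complex_inner"
proof -
  have "Im (cinner x x) = 0"
    using arg_cong[OF cinner_commute[of x x], of Im] by simp
  then show ?thesis
    by (simp add: complex_eq_iff power2_norm_eq_inner inner_eq_Re_cinner)
qed

lemma norm_scaleC: "norm (a *\<^sub>C x) = cmod a * norm x" for x :: "'a::complex_inner"
proof -
  have "complex_of_real ((norm (a *\<^sub>C x))\<^sup>2) = a * cnj a * of_real ((norm x)\<^sup>2)"
    by (simp only: cinner_self[symmetric] cinner_scaleC_left cinner_scaleC_right mult_ac)
  also have "\<dots> = of_real ((cmod a * norm x)\<^sup>2)"
    by (simp only: power_mult_distrib of_real_mult complex_norm_square)
  finally have "(norm (a *\<^sub>C x))\<^sup>2 = (cmod a * norm x)\<^sup>2"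
    using of_real_eq_iff by blast
  then show ?thesis by simp
qed

lemma scaleC_scaleR: "a *\<^sub>C (r *\<^sub>R x) = r *\<^sub>R (a *\<^sub>C x)" for x :: "'a::complex_inner"
  by (simp add: scaleR_eq_scaleC scaleC_scaleC mult.commute)

lemma bounded_linear_scaleC: "bounded_linear (\<lambda>x::'a::complex_inner. a *\<^sub>C x)"
  by (rule bounded_linear_intro[where K = "cmod a"])
    (simp_all add: scaleC_add_right scaleC_scaleR norm_scaleC mult.commute)

lemma scaleC_diff_right: "a *\<^sub>C (x - y) = a *\<^sub>C x - a *\<^sub>C y" for x y :: "'a::complex_inner"
  by (rule linear_diff[OF bounded_linear.linear[OF bounded_linear_scaleC]])

lemma cinner_eqI:
  fixes y z :: "'a::complex_inner"
  assumes "\<And>x. cinner x y = cinner x z"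
  shows "y = z"
proof -
  have "cinner (y - z) (y - z) = 0"
    using assms[of "y - z"] by (simp add: cinner_diff_right)
  then show ?thesis by (simp add: cinner_self)
qed

text \<open>Multiplying by \<i> turns the imaginary part into minus the real part, so the real inner
  product determines the sesquilinear form. Identities for \<open>inner\<close> thereby lift to
  \<open>cinner\<close> when the maps are complex linear.\<close>

lemma cinner_complex_eq: "cinner x y = Complex (inner x y) (- inner (\<i> *\<^sub>C x) y)"
  for x y :: "'a::complex_inner"
  by (simp add: complex_eq_iff inner_eq_Re_cinner cinner_scaleC_left)

text \<open>Real and imaginary parts are estimated separately, whence the factor 2. The purpose is
  to show that the values defining the numerical radius are bounded above.\<close>

lemma cmod_cinner_le:
  fixes T :: "'a::complex_inner \<Rightarrow> 'a"
  assumes "bounded_clinear T"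
  shows "cmod (cinner (T x) y) \<le> 2 * onorm T * norm x * norm y"
proof -
  have bl: "bounded_linear T" using assms by (simp add: bounded_clinear_def)
  have le: "\<bar>inner (c *\<^sub>C T x) y\<bar> \<le> onorm T * norm x * norm y" if "cmod c = 1" for c
  proof -
    have "\<bar>inner (c *\<^sub>C T x) y\<bar> \<le> norm (T x) * norm y"
      using Cauchy_Schwarz_ineq2[of "c *\<^sub>C T x" y] that by (simp add: norm_scaleC)
    also have "\<dots> \<le> onorm T * norm x * norm y"
      by (intro mult_right_mono onorm[OF bl]) simp
    finally show ?thesis .
  qed
  have "cmod (cinner (T x) y) \<le> \<bar>inner (T x) y\<bar> + \<bar>inner (\<i> *\<^sub>C T x) y\<bar>"
    using cmod_le[of "cinner (T x) y"] by (simp add: cinner_complex_eq)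
  then show ?thesis
    using le[of 1] le[of \<i>] by (simp add: scaleC_one)
qed

text \<open>For fixed \<open>y\<close>, Riesz represents the real functional sending
  \<open>x\<close> to \<open>inner (T x) y\<close>; complex linearity of \<open>T\<close> then
  upgrades the identity to \<open>cinner\<close>.\<close>

lemma cadjoint_exists:
  fixes T :: "'a::chilbert_space \<Rightarrow> 'a"
  assumes "bounded_clinear T"
  shows "\<exists>S. \<forall>x y. cinner (T x) y = cinner x (S y)"
proof -
  have bl: "bounded_linear T" and cl: "T (a *\<^sub>C x) = a *\<^sub>C T x" for a x
    using assms by (simp_all add: bounded_clinear_def)
  have "\<exists>z. \<forall>x. inner (T x) y = inner x z" for y
    by (rule riesz_representation)
      (rule bounded_linear_compose[OF bounded_linear_inner_left bl])
  then obtain S where "inner (T x) y = inner x (S y)" for x y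
    by metis
  then have "cinner (T x) y = cinner x (S y)" for x y
    by (simp add: cinner_complex_eq flip: cl)
  then show ?thesis by blast
qed

lemma cadjoint_cinner:
  fixes T :: "'a::chilbert_space \<Rightarrow> 'a"
  assumes "bounded_clinear T"
  shows "cinner (T x) y = cinner x (cadjoint T y)"
  unfolding cadjoint_def using someI_ex[OF cadjoint_exists[OF assms]] by blast

lemma cadjoint_cinner':
  fixes T :: "'a::chilbert_space \<Rightarrow> 'a"
  assumes "bounded_clinear T"
  shows "cinner (cadjoint T x) y = cinner x (T y)"
  by (simp add: cinner_commute[of "cadjoint T x"] cinner_commute[of x] cadjoint_cinner[OF assms])

lemma bounded_clinear_cadjoint:
  fixes T :: "'a::chilbert_space \<Rightarrow> 'a"
  assumes T: "bounded_clinear T"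
  shows "bounded_clinear (cadjoint T)"
  unfolding bounded_clinear_def
proof (intro conjI allI)
  have bl: "bounded_linear T" using T by (simp add: bounded_clinear_def)
  show cl: "cadjoint T (a *\<^sub>C x) = a *\<^sub>C cadjoint T x" for a x
    by (rule cinner_eqI) (simp add: cinner_simps flip: cadjoint_cinner[OF T])
  show "bounded_linear (cadjoint T)"
  proof (rule bounded_linear_intro[where K = "onorm T"])
    show "cadjoint T (x + y) = cadjoint T x + cadjoint T y" for x y
      by (rule cinner_eqI) (simp add: cinner_simps flip: cadjoint_cinner[OF T])
    show "cadjoint T (r *\<^sub>R x) = r *\<^sub>R cadjoint T x" for r x
      by (simp add: scaleR_eq_scaleC cl)
    show "norm (cadjoint T x) \<le> norm x * onorm T" for x
    proof (cases "cadjoint T x = 0")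
      case True
      then show ?thesis by (simp add: onorm_pos_le[OF bl])
    next
      case False
      \<comment> \<open>Testing the adjoint identity against \<open>?y\<close> itself leaves one
        factor \<open>norm ?y\<close> to cancel.\<close>
      let ?y = "cadjoint T x"
      have "norm ?y * norm ?y = inner (T ?y) x"
        by (simp add: inner_eq_Re_cinner cadjoint_cinner[OF T] cinner_self power2_eq_square)
      also have "\<dots> \<le> norm (T ?y) * norm x"
        by (rule norm_cauchy_schwarz)
      also have "\<dots> \<le> (onorm T * norm ?y) * norm x"
        by (intro mult_right_mono onorm[OF bl]) simp
      finally have "norm ?y * norm ?y \<le> norm ?y * (norm x * onorm T)"
        by (simp add: mult_ac)
      then show ?thesis using False by simp
    qed
  qed
qed

lemma cadjoint_cadjoint:
  fixes T :: "'a::chilbert_space \<Rightarrow> 'a"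
  assumes T: "bounded_clinear T"
  shows "cadjoint (cadjoint T) = T"
proof
  show "cadjoint (cadjoint T) x = T x" for x
    by (rule cinner_eqI)
      (simp add: cadjoint_cinner'[OF T] flip: cadjoint_cinner[OF bounded_clinear_cadjoint[OF T]])
qed

lemma bounded_clinear_compose:
  "bounded_clinear S \<Longrightarrow> bounded_clinear T \<Longrightarrow> bounded_clinear (S \<circ> T)"
  using bounded_linear_compose[of S T] by (simp add: bounded_clinear_def o_def)

section \<open>Norm bounds for symmetric operators from their quadratic forms\<close>

text \<open>By symmetry, polarisation writes \<open>4 * inner (F x) y\<close> as the difference of
  the quadratic forms at \<open>x + y\<close> and \<open>x - y\<close>; the parallelogram law then
  sums the two bounds.\<close>

lemma norm_le_of_quadratic_form_le:
  fixes F :: "'a::real_inner \<Rightarrow> 'a"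
  assumes "linear F"
    and sym: "\<And>x y. inner (F x) y = inner x (F y)"
    and bound: "\<And>x. \<bar>inner (F x) x\<bar> \<le> w * (norm x)\<^sup>2"
  shows "norm (F x) \<le> w * norm x"
proof (cases "F x = 0 \<or> x = 0")
  case True
  have "0 \<le> w * (norm x)\<^sup>2"
    using bound[of x] by linarith
  then have "x = 0 \<or> 0 \<le> w"
    by (auto simp: zero_le_mult_iff)
  then show ?thesis
    using True \<open>linear F\<close> by (auto simp: linear_0)
next
  case False
  \<comment> \<open>\<open>F x\<close> rescaled to the length of \<open>x\<close>: the direction
    makes \<open>inner (F x) y\<close> equal to \<open>norm x * norm (F x)\<close>, and the length
    turns the right-hand side into a multiple of \<open>(norm x)^2\<close>.\<close>
  define y where "y = (norm x / norm (F x)) *\<^sub>R F x"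
  have norm_y: "norm y = norm x"
    using False by (simp add: y_def)
  have "4 * inner (F x) y = inner (F (x + y)) (x + y) - inner (F (x - y)) (x - y)"
    using \<open>linear F\<close> sym[of y x]
    by (simp add: linear_add linear_diff inner_simps inner_commute[of y "F x"])
  also have "\<dots> \<le> w * ((norm (x + y))\<^sup>2 + (norm (x - y))\<^sup>2)"
    using bound[of "x + y"] bound[of "x - y"] unfolding distrib_left by linarith
  also have "(norm (x + y))\<^sup>2 + (norm (x - y))\<^sup>2 = 2 * (norm x)\<^sup>2 + 2 * (norm y)\<^sup>2"
    by (simp add: power2_norm_eq_inner inner_simps inner_commute[of y x])
  finally have "inner (F x) y \<le> w * (norm x)\<^sup>2"
    by (simp add: norm_y)
  moreover have "inner (F x) y = norm x * norm (F x)"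
    using False by (simp add: y_def dot_square_norm power2_eq_square)
  ultimately have "norm x * norm (F x) \<le> norm x * (w * norm x)"
    by (simp add: power2_eq_square mult_ac)
  then show ?thesis using False by simp
qed

subsection \<open>Square roots of positive operators\<close>

lemma scalar_sqrt_iteration:
  fixes y :: "nat \<Rightarrow> real"
  assumes y0: "y 0 = 0" and ySuc: "\<And>n. y (Suc n) = (1 + (y n)\<^sup>2) / 2"
  shows "0 \<le> y n" "y n \<le> 1" "incseq y" "Cauchy y"
proof -
  show nonneg: "0 \<le> y n" for n by (cases n) (simp_all add: y0 ySuc)
  show le1: "y n \<le> 1" for n
  proof (induction n)
    case (Suc n)
    then have "(y n)\<^sup>2 \<le> 1" using nonneg[of n] by (simp add: power_le_one)
    then show ?case by (simp add: ySuc)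
  qed (simp add: y0)
  show inc: "incseq y"
  proof (rule incseq_SucI)
    show "y n \<le> y (Suc n)" for n
      \<comment> \<open>The increment \<open>y (Suc n) - y n\<close> is exactly
        \<open>(1 - y n)^2 / 2\<close>.\<close>
      using zero_le_power2[of "1 - y n"] by (simp add: ySuc power2_eq_square algebra_simps)
  qed
  show "Cauchy y"
    using incseq_convergent[OF inc, of 1] le1 by (metis LIMSEQ_imp_Cauchy)
qed

text \<open>The fixed-point equation rearranges to \<open>(1 - L)^2 = 1 - Q\<close>, so the limit
  yields a square root of \<open>1 - Q\<close>. The bound \<open>norm L <= 1\<close> later makes
  that root positive.\<close>

lemma sqrt_iteration_blinfun:
  fixes Q :: "'a::banach \<Rightarrow>\<^sub>L 'a"
  assumes Q: "norm Q \<le> 1"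
    and Y0: "Y 0 = 0"
    and YSuc: "\<And>n. Y (Suc n) = (1 / 2) *\<^sub>R (Q + (Y n o\<^sub>L Y n))"
  shows "\<exists>L. Y \<longlonglongrightarrow> L \<and> norm L \<le> 1 \<and> 2 *\<^sub>R L = Q + (L o\<^sub>L L)"
proof -
  define y :: "nat \<Rightarrow> real" where "y = rec_nat 0 (\<lambda>_ r. (1 + r\<^sup>2) / 2)"
  have y0: "y 0 = 0" and ySuc: "\<And>n. y (Suc n) = (1 + (y n)\<^sup>2) / 2"
    by (simp_all add: y_def)
  note y = scalar_sqrt_iteration[OF y0 ySuc]
  have norm_Y: "norm (Y n) \<le> y n" for n
  proof (induction n)
    case (Suc n)
    have "norm (Q + (Y n o\<^sub>L Y n)) \<le> norm Q + norm (Y n) * norm (Y n)"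
      by (intro order_trans[OF norm_triangle_ineq] add_left_mono norm_blinfun_compose)
    also have "\<dots> \<le> 1 + y n * y n"
      using Suc Q y(1)[of n] by (intro add_mono mult_mono) auto
    finally show ?case by (simp add: YSuc ySuc power2_eq_square)
  qed (simp add: Y0 y0)
  have step: "norm (Y (Suc n) - Y n) \<le> y (Suc n) - y n" for n
  proof (induction n)
    case 0
    then show ?case using Q by (simp add: YSuc Y0 y0 ySuc)
  next
    case (Suc n)
    let ?D = "Y (Suc n) - Y n"
    have "Y (Suc (Suc n)) - Y (Suc n) = (1 / 2) *\<^sub>R ((Y (Suc n) o\<^sub>L Y (Suc n)) - (Y n o\<^sub>L Y n))"
      unfolding YSuc[of "Suc n"] YSuc[of n] by (simp add: algebra_simps)
    \<comment> \<open>A factorisation of the difference of squares that is valid without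
      commutativity. The scalar sequence satisfies the same recursion with equality, so the
      induction closes exactly.\<close>
    also have "(Y (Suc n) o\<^sub>L Y (Suc n)) - (Y n o\<^sub>L Y n) = (Y (Suc n) o\<^sub>L ?D) + (?D o\<^sub>L Y n)"
      by (rule blinfun_eqI) (simp add: blinfun.bilinear_simps)
    finally have "norm (Y (Suc (Suc n)) - Y (Suc n))
        \<le> (1 / 2) * (norm (Y (Suc n) o\<^sub>L ?D) + norm (?D o\<^sub>L Y n))"
      by (simp add: norm_triangle_ineq)
    also have "\<dots> \<le> (1 / 2) * (norm (Y (Suc n)) * norm ?D + norm ?D * norm (Y n))"
      by (intro mult_left_mono add_mono norm_blinfun_compose) simp
    also have "\<dots> \<le> (1 / 2) * (y (Suc n) * (y (Suc n) - y n) + (y (Suc n) - y n) * y n)"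
      using Suc y(1) incseq_SucD[OF y(3)]
      by (intro mult_left_mono add_mono mult_mono norm_Y) (auto intro: order_trans[OF norm_ge_zero])
    also have "\<dots> = y (Suc (Suc n)) - y (Suc n)"
      unfolding ySuc[of "Suc n"] by (simp add: ySuc[of n] power2_eq_square field_simps)
    finally show ?case .
  qed
  have increment: "norm (Y (n + k) - Y n) \<le> y (n + k) - y n" for n k
  proof (induction k)
    case (Suc k)
    have "norm (Y (n + Suc k) - Y n) \<le> norm (Y (Suc (n + k)) - Y (n + k)) + norm (Y (n + k) - Y n)"
      using norm_triangle_ineq[of "Y (Suc (n + k)) - Y (n + k)" "Y (n + k) - Y n"] by simp
    then show ?case using step[of "n + k"] Suc by simp
  qed simp
  \<comment> \<open>Distances between iterates are controlled by those of the scalar sequence, so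
    \<open>Y\<close> inherits the Cauchy property.\<close>
  have dominated: "norm (Y i - Y j) \<le> norm (y i - y j)" for i j
  proof (cases "i \<le> j")
    case True
    then show ?thesis
      using increment[of i "j - i"] by (simp add: norm_minus_commute[of "Y i"])
  next
    case False
    then show ?thesis
      using increment[of j "i - j"] by simp
  qed
  have "Cauchy Y"
    using y(4) unfolding Cauchy_iff by (meson dominated order_le_less_trans)
  then obtain L where L: "Y \<longlonglongrightarrow> L"
    by (auto simp: Cauchy_convergent_iff convergent_def)
  have "norm L \<le> 1"
    by (rule LIMSEQ_le_const2[OF tendsto_norm[OF L]]) (meson norm_Y y(2) order_trans)
  moreover have "L = (1 / 2) *\<^sub>R (Q + (L o\<^sub>L L))"
  proof (rule LIMSEQ_unique)
    show "(\<lambda>n. Y (Suc n)) \<longlonglongrightarrow> L"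
      using L by (rule LIMSEQ_Suc)
    show "(\<lambda>n. Y (Suc n)) \<longlonglongrightarrow> (1 / 2) *\<^sub>R (Q + (L o\<^sub>L L))"
      unfolding YSuc
      by (intro tendsto_intros L bounded_bilinear.tendsto[OF bounded_bilinear_blinfun_compose])
  qed
  then have "2 *\<^sub>R L = 2 *\<^sub>R ((1 / 2) *\<^sub>R (Q + (L o\<^sub>L L)))" by simp
  then have "2 *\<^sub>R L = Q + (L o\<^sub>L L)" by simp
  ultimately show ?thesis using L by blast
qed

text \<open>Reality of the quadratic form at \<open>x\<close>, \<open>y\<close> and
  \<i>\<open>x + y\<close> makes the imaginary part of the cross terms vanish, and that part is the
  difference of the two real inner products.\<close>

lemma positive_op_sym:
  fixes P :: "'a::complex_inner \<Rightarrow> 'a"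
  assumes "positive_op P"
  shows "inner (P x) y = inner x (P y)"
proof -
  have lin: "linear P" and cl: "P (a *\<^sub>C u) = a *\<^sub>C P u" for a u
    using assms by (simp_all add: positive_op_def bounded_clinear_def bounded_linear.linear)
  have "Im (cinner (P u) u) = 0" for u
    using assms by (auto simp: positive_op_def complex_nonneg_Reals_iff)
  from this[of "\<i> *\<^sub>C x + y"] this[of x] this[of y]
  have "Im (\<i> * cinner (P x) y - \<i> * cinner (P y) x) = 0"
    by (simp add: linear_add[OF lin] cl cinner_simps)
  then have "Re (cinner (P x) y) = Re (cinner (P y) x)" by simp
  then show ?thesis
    by (metis inner_commute inner_eq_Re_cinner)
qed

lemma positive_op_sqrt_exists:
  fixes P :: "'a::chilbert_space \<Rightarrow> 'a"
  assumes P: "positive_op P"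
  shows "\<exists>S. positive_op S \<and> S \<circ> S = P"
proof -
  have bl: "bounded_linear P" and cl: "P (a *\<^sub>C u) = a *\<^sub>C P u" for a u
    using P by (simp_all add: positive_op_def bounded_clinear_def)
  note sym = positive_op_sym[OF P]
  have nonneg: "0 \<le> inner (P x) x" for x
    using P by (auto simp: positive_op_def complex_nonneg_Reals_iff inner_eq_Re_cinner)
  \<comment> \<open>Dividing by \<open>M\<close> places the form of \<open>P\<close> between 0 and
    \<open>(norm u)^2\<close>, hence that of \<open>Q = 1 - P / M\<close> too. Adding 1 keeps
    \<open>M\<close> positive even for \<open>P = 0\<close>.\<close>
  define M where "M = onorm P + 1"
  have M: "M > 0" using onorm_pos_le[OF bl] by (simp add: M_def)
  define Q where "Q = Blinfun (\<lambda>x. x - (1 / M) *\<^sub>R P x)"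
  have Q: "blinfun_apply Q x = x - (1 / M) *\<^sub>R P x" for x
    unfolding Q_def
    by (subst bounded_linear_Blinfun_apply)
      (intro bounded_linear_sub bounded_linear_ident bounded_linear_const_scaleR bl, simp)
  have Q_sym: "inner (Q x) y = inner x (Q y)" for x y
    by (simp add: Q inner_simps sym)
  have Q_cl: "Q (a *\<^sub>C x) = a *\<^sub>C Q x" for a x
    by (simp add: Q cl scaleC_diff_right scaleC_scaleR)
  have "norm (Q x) \<le> 1 * norm x" for x
  proof (rule norm_le_of_quadratic_form_le[OF _ Q_sym])
    show "linear Q" by (simp add: bounded_linear.linear blinfun.bounded_linear_right)
    fix u
    have "inner (P u) u \<le> norm (P u) * norm u" by (rule norm_cauchy_schwarz)
    also have "\<dots> \<le> M * norm u * norm u"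
      using onorm[OF bl, of u] mult_right_mono[of "onorm P" M "norm u"]
      by (intro mult_right_mono) (auto simp: M_def)
    finally have "inner (P u) u / M \<le> (norm u)\<^sup>2"
      using M by (simp add: field_simps power2_eq_square)
    moreover have "inner (Q u) u = (norm u)\<^sup>2 - inner (P u) u / M"
      by (simp add: Q inner_simps power2_norm_eq_inner)
    moreover have "0 \<le> inner (P u) u / M" using nonneg M by simp
    ultimately show "\<bar>inner (Q u) u\<bar> \<le> 1 * (norm u)\<^sup>2" by simp
  qed
  then have Q_norm: "norm Q \<le> 1"
    by (intro norm_blinfun_bound) simp_all
  define Y :: "nat \<Rightarrow> 'a \<Rightarrow>\<^sub>L 'a" where "Y = rec_nat 0 (\<lambda>_ Z. (1 / 2) *\<^sub>R (Q + (Z o\<^sub>L Z)))"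
  have Y0: "Y 0 = 0" and YSuc: "\<And>n. Y (Suc n) = (1 / 2) *\<^sub>R (Q + (Y n o\<^sub>L Y n))"
    by (simp_all add: Y_def)
  obtain L where L: "Y \<longlonglongrightarrow> L" and L_norm: "norm L \<le> 1" and L_eq: "2 *\<^sub>R L = Q + (L o\<^sub>L L)"
    using sqrt_iteration_blinfun[OF Q_norm Y0 YSuc] by blast
  have lim: "(\<lambda>n. Y n x) \<longlonglongrightarrow> L x" for x
    by (intro blinfun.tendsto L tendsto_const)
  \<comment> \<open>Symmetry, and below complex linearity, pass from \<open>Q\<close> to every
    iterate and then to the limit.\<close>
  have Y_sym: "inner (Y n x) y = inner x (Y n y)" for n x y
    by (induction n arbitrary: x y) (simp_all add: Y0 YSuc blinfun.bilinear_simps inner_simps Q_sym)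
  have L_sym: "inner (L x) y = inner x (L y)" for x y
  proof (rule LIMSEQ_unique)
    show "(\<lambda>n. inner (Y n x) y) \<longlonglongrightarrow> inner (L x) y" by (intro tendsto_intros lim)
    show "(\<lambda>n. inner (Y n x) y) \<longlonglongrightarrow> inner x (L y)" unfolding Y_sym by (intro tendsto_intros lim)
  qed
  have Y_cl: "Y n (a *\<^sub>C x) = a *\<^sub>C Y n x" for n a x
    by (induction n arbitrary: x)
      (simp_all add: Y0 YSuc blinfun.bilinear_simps Q_cl scaleC_add_right scaleC_scaleR
        linear_0[OF bounded_linear.linear[OF bounded_linear_scaleC]])
  have L_cl: "L (a *\<^sub>C x) = a *\<^sub>C L x" for a x
  proof (rule LIMSEQ_unique)
    show "(\<lambda>n. Y n (a *\<^sub>C x)) \<longlonglongrightarrow> L (a *\<^sub>C x)" by (rule lim)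
    show "(\<lambda>n. Y n (a *\<^sub>C x)) \<longlonglongrightarrow> a *\<^sub>C L x"
      unfolding Y_cl by (rule bounded_linear.tendsto[OF bounded_linear_scaleC lim])
  qed
  \<comment> \<open>The factor \<open>sqrt M\<close> undoes the scaling, since
    \<open>(1 - L)^2 = 1 - Q = P / M\<close>.\<close>
  define S where "S x = sqrt M *\<^sub>R (x - L x)" for x
  have S_bl: "bounded_linear S"
    unfolding S_def
    by (intro bounded_linear_const_scaleR bounded_linear_sub bounded_linear_ident
        blinfun.bounded_linear_right)
  have S_cl: "S (a *\<^sub>C x) = a *\<^sub>C S x" for a x
    by (simp add: S_def L_cl scaleC_diff_right scaleC_scaleR)
  have S_sym: "inner (S x) y = inner x (S y)" for x y
    by (simp add: S_def inner_simps L_sym)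
  have S_nonneg: "0 \<le> inner (S x) x" for x
  proof -
    have "inner (L x) x \<le> norm (L x) * norm x" by (rule norm_cauchy_schwarz)
    also have "\<dots> \<le> (norm L * norm x) * norm x"
      by (intro mult_right_mono norm_blinfun) simp
    also have "\<dots> \<le> (1 * norm x) * norm x"
      by (intro mult_right_mono L_norm) simp_all
    finally show ?thesis
      using M by (simp add: S_def inner_simps dot_square_norm power2_eq_square)
  qed
  \<comment> \<open>Real symmetry tested on \<i>\<open>x\<close> and \<open>x\<close> shows that
    \<open>cinner (S x) x\<close> and its conjugate have equal imaginary parts, so the form is
    real.\<close>
  have "cinner (S x) x \<in> \<real>\<^sub>\<ge>\<^sub>0" for x
  proof -
    have "Re (cinner (S (\<i> *\<^sub>C x)) x) = Re (cinner (\<i> *\<^sub>C x) (S x))"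
      using S_sym[of "\<i> *\<^sub>C x" x] by (simp add: inner_eq_Re_cinner)
    then have "Im (cinner (S x) x) = Im (cinner x (S x))"
      by (simp add: S_cl cinner_simps)
    moreover have "Im (cinner x (S x)) = - Im (cinner (S x) x)"
      using arg_cong[OF cinner_commute[of x "S x"], of Im] by simp
    ultimately show ?thesis
      using S_nonneg[of x] by (simp add: complex_nonneg_Reals_iff inner_eq_Re_cinner)
  qed
  then have "positive_op S"
    using S_bl S_cl by (simp add: positive_op_def bounded_clinear_def)
  moreover have "S (S x) = P x" for x
  proof -
    have eq: "L (L x) = 2 *\<^sub>R L x - Q x"
      using arg_cong[OF L_eq, of "\<lambda>F. blinfun_apply F x"] by (simp add: blinfun.bilinear_simps)
    have "S (S x) = M *\<^sub>R (x - L x - (L x - L (L x)))"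
      using M by (simp add: S_def blinfun.bilinear_simps flip: scaleR_diff_right)
    also have "\<dots> = M *\<^sub>R (x - Q x)"
      by (simp add: eq scaleR_2)
    also have "\<dots> = P x"
      using M by (simp add: Q)
    finally show ?thesis .
  qed
  ultimately show ?thesis by (auto simp: fun_eq_iff)
qed

text \<open>The form of \<open>cadjoint T \<circ> T\<close> at \<open>x\<close> is
  \<open>(norm (T x))^2\<close>, so a positive root exists and the chosen one squares to this
  product.\<close>

lemma op_abs_square:
  fixes T :: "'a::chilbert_space \<Rightarrow> 'a"
  assumes T: "bounded_clinear T"
  shows "op_abs T ^^ 2 = cadjoint T \<circ> T"
proof -
  have "positive_op (cadjoint T \<circ> T)"
    unfolding positive_op_def
    using bounded_clinear_compose[OF bounded_clinear_cadjoint[OF T] T]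
    by (simp add: cadjoint_cinner'[OF T] cinner_self complex_nonneg_Reals_iff)
  from someI_ex[OF positive_op_sqrt_exists[OF this]] show ?thesis
    by (simp add: op_abs_def op_sqrt_def numeral_2_eq_2)
qed

subsection \<open>Cartesian decomposition and numerical radius\<close>

lemma bounded_clinear_op_Re:
  fixes T :: "'a::chilbert_space \<Rightarrow> 'a"
  assumes T: "bounded_clinear T"
  shows "bounded_clinear (op_Re T)"
  unfolding bounded_clinear_def
proof (intro conjI allI)
  note S = bounded_clinear_cadjoint[OF T]
  show "bounded_linear (op_Re T)"
    unfolding op_Re_def using T S
    by (intro bounded_linear_compose[OF bounded_linear_scaleC] bounded_linear_add)
      (simp_all add: bounded_clinear_def)
  show "op_Re T (a *\<^sub>C x) = a *\<^sub>C op_Re T x" for a x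
    using T S
    by (simp add: bounded_clinear_def op_Re_def scaleC_add_right scaleC_scaleC mult.commute)
qed

lemma bounded_clinear_op_Im:
  fixes T :: "'a::chilbert_space \<Rightarrow> 'a"
  assumes T: "bounded_clinear T"
  shows "bounded_clinear (op_Im T)"
  unfolding bounded_clinear_def
proof (intro conjI allI)
  note S = bounded_clinear_cadjoint[OF T]
  show "bounded_linear (op_Im T)"
    unfolding op_Im_def using T S
    by (intro bounded_linear_compose[OF bounded_linear_scaleC] bounded_linear_sub)
      (simp_all add: bounded_clinear_def)
  show "op_Im T (a *\<^sub>C x) = a *\<^sub>C op_Im T x" for a x
    using T S
    by (simp add: bounded_clinear_def op_Im_def scaleC_diff_right scaleC_scaleC mult.commute)
qed

lemma op_Re_sym:
  fixes T :: "'a::chilbert_space \<Rightarrow> 'a"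
  assumes "bounded_clinear T"
  shows "cinner (op_Re T x) y = cinner x (op_Re T y)"
  by (simp add: op_Re_def cinner_simps cadjoint_cinner[OF assms] cadjoint_cinner'[OF assms])

lemma op_Im_sym:
  fixes T :: "'a::chilbert_space \<Rightarrow> 'a"
  assumes "bounded_clinear T"
  shows "cinner (op_Im T x) y = cinner x (op_Im T y)"
  by (simp add: op_Im_def cinner_simps cadjoint_cinner[OF assms] cadjoint_cinner'[OF assms]
      field_simps)

lemma cartesian_decomposition:
  fixes T :: "'a::chilbert_space \<Rightarrow> 'a"
  shows "T x = op_Re T x + \<i> *\<^sub>C op_Im T x"
    and "cadjoint T x = op_Re T x - \<i> *\<^sub>C op_Im T x"
proof -
  have "\<i> *\<^sub>C op_Im T x = (1 / 2) *\<^sub>C (T x - cadjoint T x)"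
    by (simp add: op_Im_def scaleC_scaleC)
  moreover have half: "v = (1 / 2) *\<^sub>C v + (1 / 2) *\<^sub>C v" for v :: 'a
    by (simp add: scaleC_one flip: scaleC_add_left)
  ultimately show "T x = op_Re T x + \<i> *\<^sub>C op_Im T x"
    and "cadjoint T x = op_Re T x - \<i> *\<^sub>C op_Im T x"
    using half[of "T x"] half[of "cadjoint T x"]
    by (simp_all add: op_Re_def scaleC_add_right scaleC_diff_right)
qed

text \<open>Expanding \<open>(A - iB)(A + iB) + (A + iB)(A - iB)\<close>, the mixed terms in
  \<open>AB\<close> and \<open>BA\<close> cancel without any commutation.\<close>

lemma cadjoint_products_sum:
  fixes T :: "'a::chilbert_space \<Rightarrow> 'a"
  assumes T: "bounded_clinear T"
  shows "cadjoint T (T x) + T (cadjoint T x)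
    = 2 *\<^sub>R (op_Re T (op_Re T x) + op_Im T (op_Im T x))"
proof -
  let ?A = "op_Re T" and ?B = "op_Im T"
  have lin: "linear ?A" "linear ?B"
    and cl: "?A (a *\<^sub>C u) = a *\<^sub>C ?A u" "?B (a *\<^sub>C u) = a *\<^sub>C ?B u" for a u
    using bounded_clinear_op_Re[OF T] bounded_clinear_op_Im[OF T]
    by (simp_all add: bounded_clinear_def bounded_linear.linear)
  have "cadjoint T (T x) = ?A (?A x + \<i> *\<^sub>C ?B x) - \<i> *\<^sub>C ?B (?A x + \<i> *\<^sub>C ?B x)"
    by (metis cartesian_decomposition)
  moreover have "T (cadjoint T x) = ?A (?A x - \<i> *\<^sub>C ?B x) + \<i> *\<^sub>C ?B (?A x - \<i> *\<^sub>C ?B x)"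
    by (metis cartesian_decomposition)
  ultimately show ?thesis
    by (simp add: linear_add[OF lin(1)] linear_add[OF lin(2)] linear_diff[OF lin(1)]
        linear_diff[OF lin(2)] cl scaleC_add_right scaleC_diff_right scaleC_scaleC
        scaleC_minus_one scaleR_2)
qed

section \<open>Bounds for and by the numerical radius\<close>

lemma numerical_radius_le:
  assumes "0 \<le> w" and "\<And>x. norm x = 1 \<Longrightarrow> cmod (cinner (T x) x) \<le> w"
  shows "numerical_radius T \<le> w"
  unfolding numerical_radius_def using assms by (intro cSup_least) auto

text \<open>The set of values is bounded above, so its supremum dominates each member; degree-two
  homogeneity carries the bound from unit vectors to all vectors.\<close>

lemma numerical_radius_upper:
  fixes T :: "'a::complex_inner \<Rightarrow> 'a"
  assumes T: "bounded_clinear T"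
  shows "0 \<le> numerical_radius T"
    and "cmod (cinner (T x) x) \<le> numerical_radius T * (norm x)\<^sup>2"
proof -
  let ?V = "insert 0 {cmod (cinner (T x) x) | x. norm x = 1}"
  have bl: "bounded_linear T" using T by (simp add: bounded_clinear_def)
  have "v \<le> 2 * onorm T" if "v \<in> ?V" for v
    using that
  proof
    assume "v = 0"
    then show ?thesis using onorm_pos_le[OF bl] by simp
  next
    assume "v \<in> {cmod (cinner (T x) x) | x. norm x = 1}"
    then obtain u where "v = cmod (cinner (T u) u)" "norm u = 1" by blast
    then show ?thesis using cmod_cinner_le[OF T, of u u] by simp
  qed
  then have bdd: "bdd_above ?V" by (rule bdd_aboveI)
  show "0 \<le> numerical_radius T"
    unfolding numerical_radius_def by (rule cSup_upper[OF _ bdd]) simp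
  show "cmod (cinner (T x) x) \<le> numerical_radius T * (norm x)\<^sup>2"
  proof (cases "x = 0")
    case True
    then show ?thesis by (simp add: linear_0[OF bounded_linear.linear[OF bl]] cinner_self)
  next
    case False
    define u where "u = (1 / norm x) *\<^sub>R x"
    have "cmod (cinner (T u) u) \<le> numerical_radius T"
      unfolding numerical_radius_def using False by (intro cSup_upper[OF _ bdd]) (auto simp: u_def)
    moreover have "cmod (cinner (T u) u) = cmod (cinner (T x) x) / (norm x)\<^sup>2"
      by (simp add: u_def linear_cmul[OF bounded_linear.linear[OF bl]] cinner_simps norm_mult
          norm_divide power2_eq_square)
    ultimately show ?thesis using False by (simp add: field_simps)
  qed
qed

text \<open>The forms of \<open>op_Re T\<close> and \<open>op_Im T\<close> are the real and
  imaginary parts of \<open>cinner (T u) u\<close>; symmetry turns their bounds into norm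
  bounds.\<close>

lemma norm_op_Re_op_Im_le_numerical_radius:
  fixes T :: "'a::chilbert_space \<Rightarrow> 'a"
  assumes T: "bounded_clinear T"
  shows "norm (op_Re T x) \<le> numerical_radius T * norm x"
    and "norm (op_Im T x) \<le> numerical_radius T * norm x"
proof -
  let ?A = "op_Re T" and ?B = "op_Im T" and ?w = "numerical_radius T"
  have lin: "linear ?A" "linear ?B"
    using bounded_clinear_op_Re[OF T] bounded_clinear_op_Im[OF T]
    by (simp_all add: bounded_clinear_def bounded_linear.linear)
  have conj: "cinner (cadjoint T u) u = cnj (cinner (T u) u)" for u
    by (metis cadjoint_cinner'[OF T] cinner_commute)
  have re: "inner (?A u) u = Re (cinner (T u) u)"
    and im: "inner (?B u) u = Im (cinner (T u) u)" for u
    by (simp_all add: inner_eq_Re_cinner op_Re_def op_Im_def cinner_simps conj complex_eq_iff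
        Re_divide Im_divide)
  have bounds: "\<bar>inner (?A u) u\<bar> \<le> ?w * (norm u)\<^sup>2" "\<bar>inner (?B u) u\<bar> \<le> ?w * (norm u)\<^sup>2" for u
    unfolding re im using numerical_radius_upper(2)[OF T, of u]
    by (meson abs_Re_le_cmod abs_Im_le_cmod order_trans)+
  show "norm (?A x) \<le> ?w * norm x"
    by (rule norm_le_of_quadratic_form_le[OF lin(1) _ bounds(1)])
      (simp add: inner_eq_Re_cinner op_Re_sym[OF T])
  show "norm (?B x) \<le> ?w * norm x"
    by (rule norm_le_of_quadratic_form_le[OF lin(2) _ bounds(2)])
      (simp add: inner_eq_Re_cinner op_Im_sym[OF T])
qed

section \<open>The two inequalities\<close>

theorem corollary2p4:
  fixes T A B :: "'a::chilbert_space \<Rightarrow> 'a"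
  assumes "bounded_clinear T"
    and "A = op_Re T" and "B = op_Im T"
  shows "1 / 4 * onorm (\<lambda>x. (op_abs T ^^ 2) x + (op_abs (cadjoint T) ^^ 2) x)
           \<le> sqrt 2 / 2 * numerical_radius (\<lambda>x. (A ^^ 2) x + \<i> *\<^sub>C (B ^^ 2) x)
       \<and> sqrt 2 / 2 * numerical_radius (\<lambda>x. (A ^^ 2) x + \<i> *\<^sub>C (B ^^ 2) x)
           \<le> (numerical_radius T)\<^sup>2"
proof -
  note T = assms(1)
  let ?D = "\<lambda>x. (A ^^ 2) x + \<i> *\<^sub>C (B ^^ 2) x"
  let ?d = "numerical_radius ?D" and ?w = "numerical_radius T"
  have A: "bounded_clinear A" and B: "bounded_clinear B"
    and A_sym: "cinner (A x) y = cinner x (A y)"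
    and B_sym: "cinner (B x) y = cinner x (B y)" for x y
    using bounded_clinear_op_Re[OF T] bounded_clinear_op_Im[OF T] op_Re_sym[OF T] op_Im_sym[OF T]
    by (simp_all add: assms)
  have AA: "bounded_linear (\<lambda>x. A (A x))" and BB: "bounded_linear (\<lambda>x. B (B x))"
    using A B by (auto simp: bounded_clinear_def intro: bounded_linear_compose)
  have D: "bounded_clinear ?D"
    using A B AA BB
    by (auto simp: bounded_clinear_def numeral_2_eq_2 scaleC_add_right scaleC_scaleC mult.commute
        intro!: bounded_linear_add bounded_linear_compose[OF bounded_linear_scaleC])
  \<comment> \<open>Self-adjointness turns the forms of the squares of \<open>A\<close> and
    \<open>B\<close> into squared norms, which become the real and imaginary parts.\<close>
  have D_form: "cinner (?D x) x = Complex ((norm (A x))\<^sup>2) ((norm (B x))\<^sup>2)" for x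
    by (simp add: numeral_2_eq_2 cinner_simps A_sym[of "A x"] B_sym[of "B x"] cinner_self
        complex_eq_iff)
  have D_norm: "cmod (cinner (?D x) x) = sqrt (((norm (A x))\<^sup>2)\<^sup>2 + ((norm (B x))\<^sup>2)\<^sup>2)" for x
    by (simp add: D_form complex_norm)

  let ?P = "\<lambda>x. A (A x) + B (B x)"
  have P_form: "inner (?P x) x = (norm (A x))\<^sup>2 + (norm (B x))\<^sup>2" for x
    by (simp add: inner_eq_Re_cinner cinner_simps A_sym[of "A x"] B_sym[of "B x"] cinner_self)
  have "norm (?P x) \<le> (sqrt 2 * ?d) * norm x" for x
  proof (rule norm_le_of_quadratic_form_le)
    show "linear ?P" by (intro bounded_linear.linear bounded_linear_add AA BB)
    show "inner (?P u) v = inner u (?P v)" for u v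
      by (simp add: inner_eq_Re_cinner cinner_simps A_sym B_sym)
    fix u
    let ?a = "(norm (A u))\<^sup>2" and ?b = "(norm (B u))\<^sup>2"
    have "\<bar>inner (?P u) u\<bar> = ?a + ?b" by (simp add: P_form)
    \<comment> \<open>After squaring this is \<open>0 <= (?a - ?b)^2\<close>.\<close>
    also have "\<dots> \<le> sqrt 2 * sqrt (?a\<^sup>2 + ?b\<^sup>2)"
      unfolding real_sqrt_mult[symmetric] using zero_le_power2[of "?a - ?b"]
      by (intro real_le_rsqrt) (simp add: power2_eq_square algebra_simps)
    also have "\<dots> \<le> sqrt 2 * (?d * (norm u)\<^sup>2)"
      using numerical_radius_upper(2)[OF D, of u] unfolding D_norm by (intro mult_left_mono) auto
    finally show "\<bar>inner (?P u) u\<bar> \<le> (sqrt 2 * ?d) * (norm u)\<^sup>2" by (simp add: mult.assoc)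
  qed
  then have "norm (2 *\<^sub>R ?P x) \<le> (2 * sqrt 2 * ?d) * norm x" for x
    by (simp add: mult.assoc)
  then have "onorm (\<lambda>x. 2 *\<^sub>R ?P x) \<le> 2 * sqrt 2 * ?d"
    using numerical_radius_upper(1)[OF D] by (intro onorm_bound) auto
  moreover have "(op_abs T ^^ 2) x + (op_abs (cadjoint T) ^^ 2) x = 2 *\<^sub>R ?P x" for x
    using cadjoint_products_sum[OF T, of x]
    by (simp add: op_abs_square T bounded_clinear_cadjoint cadjoint_cadjoint assms(2,3))
  ultimately have lower:
    "1 / 4 * onorm (\<lambda>x. (op_abs T ^^ 2) x + (op_abs (cadjoint T) ^^ 2) x) \<le> sqrt 2 / 2 * ?d"
    by simp
  have d_le: "?d \<le> sqrt 2 * ?w\<^sup>2"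
  proof (rule numerical_radius_le)
    fix x :: 'a assume "norm x = 1"
    then have "norm (A x) \<le> ?w" "norm (B x) \<le> ?w"
      using norm_op_Re_op_Im_le_numerical_radius[OF T, of x] by (simp_all add: assms(2,3))
    then have "((norm (A x))\<^sup>2)\<^sup>2 + ((norm (B x))\<^sup>2)\<^sup>2 \<le> (?w\<^sup>2)\<^sup>2 + (?w\<^sup>2)\<^sup>2"
      by (intro add_mono power_mono) auto
    then have "sqrt (((norm (A x))\<^sup>2)\<^sup>2 + ((norm (B x))\<^sup>2)\<^sup>2) \<le> sqrt (2 * (?w\<^sup>2)\<^sup>2)"
      by (intro real_sqrt_le_mono) simp
    also have "\<dots> = sqrt 2 * ?w\<^sup>2"
      by (simp only: real_sqrt_mult real_sqrt_abs abs_power2)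
    finally show "cmod (cinner (?D x) x) \<le> sqrt 2 * ?w\<^sup>2"
      unfolding D_norm .
  qed simp
  \<comment> \<open>The \<open>sqrt 2\<close> from two equal bounds under the root in
    \<open>d_le\<close> cancels against the prefactor.\<close>
  have "sqrt 2 / 2 * ?d \<le> sqrt 2 / 2 * (sqrt 2 * ?w\<^sup>2)"
    by (intro mult_left_mono d_le) simp
  also have "\<dots> = ?w\<^sup>2"
    by simp
  finally show ?thesis
    using lower by blast
qed

end
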